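(* Let $\theta\in(0,2\pi)$ be an irrational multiple of $2\pi$ such that $x=\theta/2\pi$ is of bounded type, let $E>0$, and define $b:[0,\infty)\to\mathbb{R}$ by $$b(r)=\inf_{k\ge 1}\ \frac{1}{\sqrt{E}}\sqrt{(1-\cos k\theta)\,r^2+k^2},$$ the infimum being over positive integers $k$. Then the function $b(r)$ is comparable to $\sqrt{r}$.
   Context: Let $[a_0,a_1,a_2,\dots]$ be the infinite continued fraction expansion of the irrational number $x$. The number $x$ is of bounded type if there is a constant $D$ with $a_n\le D$ for all $n$. For functions $F,G$ of a variable $m$ (here a real variable $r\ge 0$), $F$ is comparable to $G$ if there exist positive constants $k_1,k_2,M$ such that $k_1G(m)<F(m)<k_2G(m)$ for all $m>M$. (Geometric origin: $u=b(\sqrt{x^2+y^2})$ is the boundary in $\mathbb{H}^4=\{(x,y,z,u):u>0\}$ of the Margulis region of the screw parabolic isometry $g(x,y,z,u)=(x\cos\theta-y\sin\theta,\,x\sin\theta+y\cos\theta,\,z+\sqrt2,\,u)$, with $E=\cosh\epsilon-1$ where $\epsilon>0$ is the constant defining the Margulis region.) *)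

theory Defs
  imports Complex_Main
begin

(* Complete quotients: for irrational x every fractional part below is nonzero,
   so the division is genuine and the expansion is infinite. *)
primrec complete_quotient :: "real \<Rightarrow> nat \<Rightarrow> real" where
  "complete_quotient x 0 = x"
| "complete_quotient x (Suc n) = 1 / frac (complete_quotient x n)"

definition cf_coeff :: "real \<Rightarrow> nat \<Rightarrow> int" where
  "cf_coeff x n = \<lfloor>complete_quotient x n\<rfloor>"

definition bounded_type :: "real \<Rightarrow> bool" where
  "bounded_type x \<longleftrightarrow> x \<notin> \<rat> \<and> (\<exists>D. \<forall>n. cf_coeff x n \<le> D)"

definition comparable :: "(real \<Rightarrow> real) \<Rightarrow> (real \<Rightarrow> real) \<Rightarrow> bool" where
  "comparable F G \<longleftrightarrow>
     (\<exists>k1 k2 M. 0 < k1 \<and> 0 < k2 \<and> 0 < M \<and>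
        (\<forall>m>M. k1 * G m < F m \<and> F m < k2 * G m))"

(* Of interest for r \<ge> 0 only; comparability looks only at r > M > 0. The infimum
   is over a nonempty set bounded below by 0, so Inf on the reals is the true infimum. *)
definition margulis_boundary :: "real \<Rightarrow> real \<Rightarrow> real \<Rightarrow> real" where
  "margulis_boundary E \<theta> r =
     (INF k\<in>{k::nat. 1 \<le> k}.
        1 / sqrt E * sqrt ((1 - cos (real k * \<theta>)) * r\<^sup>2 + (real k)\<^sup>2))"

end

theory Submission
  imports Defs "HOL-Analysis.Kronecker_Approximation_Theorem"
begin

text \<open>
  With \<open>x = \<theta> / (2 * pi)\<close> and \<open>p\<close> any integer, \<open>1 - cos (k * \<theta>) = 2 * (sin (pi * (k * x - p)))\<^sup>2\<close>, and
  for \<open>p\<close> nearest to \<open>k * x\<close> this is \<open>(k * x - p)\<^sup>2\<close> up to constant factors. The function under the infimum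
  is therefore comparable to the square root of \<open>(k * x - p)\<^sup>2 * r\<^sup>2 + k\<^sup>2\<close>, and the theorem is a statement about how
  well multiples of \<open>x\<close> approach the integers.

  For the upper bound, Dirichlet's theorem gives some \<open>k \<le> N\<close> with \<open>\<bar>k * x - p\<bar> < 1 / N\<close>, and
  the choice \<open>N \<approx> sqrt r\<close> makes both summands \<open>O(r)\<close>.

  The lower bound is where bounded type enters. It makes \<open>x\<close> badly approximable:
  \<open>k * \<bar>k * x - p\<bar> \<ge> c\<close> for some constant \<open>c > 0\<close> (\<open>bounded_type_badly_approximable\<close>). The two summands
  then have product at least \<open>c\<^sup>2 * r\<^sup>2\<close>, up to a constant, so by the inequality of arithmetic and geometric
  means their sum is at least a multiple of \<open>r\<close>, whatever \<open>k\<close> is.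

  Bad approximability is proved without convergents, by a descent
  (\<open>gauss_orbit_badly_approximable\<close>): a good approximation \<open>p / q\<close> of a fractional part \<open>\<alpha>\<close> yields an
  approximation, of smaller denominator and no larger value of \<open>q * \<bar>q * \<alpha> - p\<bar>\<close>, of one of the next two
  points in the orbit of \<open>\<alpha>\<close> under the Gauss map \<open>\<alpha> \<mapsto> frac (1 / \<alpha>)\<close>. The descent can only stop at a pair for
  which the bound is immediate, because bounded partial quotients keep the orbit away from 0.
\<close>

section \<open>Bounded partial quotients and bad approximability\<close>

text \<open>
  Write \<open>\<alpha>\<close> for \<open>\<alpha> n\<close>, \<open>\<alpha>'\<close> for \<open>\<alpha> (Suc n)\<close> and let \<open>q' = q - a n * p\<close>. The identity \<open>q * \<alpha> - p = - \<alpha> * (p * \<alpha>' - q')\<close> passes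
  from \<open>(q, p)\<close> at \<open>\<alpha>\<close> to \<open>(p, q')\<close> at \<open>\<alpha>'\<close>, and it changes the product of denominator and error by
  the factor \<open>p / (q * \<alpha>)\<close>. This does not increase the product exactly when \<open>p \<le> q * \<alpha>\<close>. If \<open>p > q * \<alpha>\<close>, two
  such steps have combined factor \<open>q' / (q * \<alpha> * \<alpha>')\<close>, which is then at most 1
  because \<open>q * \<alpha> * \<alpha>' - q' = a n * (p - q * \<alpha>)\<close>. The pairs with \<open>p \<le> 0\<close> or \<open>q' \<le> 0\<close> end the descent; there the
  two terms of the error do not cancel, and it is at least \<open>q * \<alpha>\<close> or \<open>p * \<alpha> * \<alpha>'\<close>.
\<close>

lemma gauss_orbit_badly_approximable:
  fixes \<alpha> :: "nat \<Rightarrow> real" and a :: "nat \<Rightarrow> int" and \<delta> :: real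
  assumes \<delta>: "0 < \<delta>"
    and bounds: "\<And>n. \<delta> \<le> \<alpha> n" "\<And>n. \<alpha> n < 1"
    and a_pos: "\<And>n. 1 \<le> a n"
    and step: "\<And>n. 1 / \<alpha> n = a n + \<alpha> (Suc n)"
    and q: "1 \<le> q"
  shows "\<delta>\<^sup>2 \<le> real q * \<bar>real q * \<alpha> n - of_int p\<bar>"
  using q
proof (induction q arbitrary: n p rule: less_induct)
  case (less q)
  define A where "A = \<alpha> n"
  define B where "B = \<alpha> (Suc n)"
  define Q where "Q = real q"
  define P where "P = real_of_int p"
  have A: "\<delta> \<le> A" "A < 1" "0 < A" and B: "\<delta> \<le> B" "B < 1" "0 < B"
    using bounds[of n] bounds[of "Suc n"] \<delta> by (auto simp: A_def B_def)
  have Q: "1 \<le> Q" using less.prems by (simp add: Q_def)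
  have \<delta>2: "\<delta>\<^sup>2 \<le> A * B"
    unfolding power2_eq_square using A B \<delta> by (intro mult_mono) auto
  have AB: "A * a n + A * B = 1"
    using step[of n] A(3) by (simp add: A_def B_def field_simps)
  consider "p \<le> 0" | "1 \<le> p" "P \<le> Q * A" | "1 \<le> p" "Q * A < P"
    by linarith
  then have "\<delta>\<^sup>2 \<le> Q * \<bar>Q * A - P\<bar>"
  proof cases
    case 1
    have "\<delta>\<^sup>2 \<le> A * 1"
      unfolding power2_eq_square using A \<delta> by (intro mult_mono) auto
    also have "A * 1 \<le> (Q * A) * Q"
      using A Q mult_mono[of 1 Q A "Q * A"] mult_mono[of A "Q * A" 1 Q] by auto
    also have "\<dots> \<le> Q * (Q * A - P)"
      using 1 Q by (simp add: P_def algebra_simps mult_nonneg_nonpos)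
    also have "\<dots> \<le> Q * \<bar>Q * A - P\<bar>"
      using Q by (intro mult_left_mono) auto
    finally show ?thesis .
  next
    case 2
    have "P < Q"
      using 2 A Q by (smt (verit) mult_less_cancel_left2)
    define m where "m = nat p"
    have m: "real m = P" "1 \<le> m" "m < q"
      using 2 \<open>P < Q\<close> by (auto simp: m_def P_def Q_def nat_less_iff)
    have "\<delta>\<^sup>2 \<le> real m * \<bar>real m * \<alpha> (Suc n) - of_int (int q - a n * p)\<bar>"
      using m by (intro less.IH) auto
    also have "\<dots> = P * \<bar>P * B - (Q - a n * P)\<bar>"
      by (simp add: m B_def P_def Q_def)
    also have "P * B - (Q - a n * P) = (P - Q * A) / A"
    proof -
      have "P * (A * a n + A * B) = P"
        by (simp add: AB)
      then show ?thesis
        using A(3) by (simp add: field_simps)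
    qed
    also have "P * \<bar>(P - Q * A) / A\<bar> \<le> (Q * A) * \<bar>(P - Q * A) / A\<bar>"
      using 2 by (intro mult_right_mono) auto
    also have "\<dots> = Q * \<bar>Q * A - P\<bar>"
      using A by (simp add: abs_minus_commute)
    finally show ?thesis .
  next
    case 3
    define q' where "q' = int q - a n * p"
    define Q' where "Q' = real_of_int q'"
    have Q': "Q' = Q - a n * P"
      by (simp add: Q'_def q'_def Q_def P_def)
    have P1: "1 \<le> P" using 3 by (simp add: P_def)
    have PA: "P * (A * a n + A * B) = P"
      by (simp add: AB)
    have err: "P - Q * A = A * (P * B - Q')"
      using PA by (simp add: Q' algebra_simps)
    have abs_err: "\<bar>Q * A - P\<bar> = P - Q * A"
      using 3 by simp
    show ?thesis
    proof (cases "q' \<le> 0")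
      case True
      have "\<delta>\<^sup>2 \<le> A * B" by (rule \<delta>2)
      also have "A * B \<le> Q * (A * (P * B))"
      proof -
        have "1 * 1 \<le> Q * P" using Q P1 by (intro mult_mono) auto
        then show ?thesis
          using A B mult_right_mono[of 1 "Q * P" "A * B"] by (simp add: algebra_simps)
      qed
      also have "\<dots> \<le> Q * (A * (P * B - Q'))"
        using True A Q by (intro mult_left_mono) (auto simp: Q'_def)
      finally show ?thesis by (simp add: abs_err err)
    next
      case False
      define m where "m = nat q'"
      have "1 * 1 \<le> a n * p" using a_pos[of n] 3 by (intro mult_mono) auto
      then have m: "real m = Q'" "1 \<le> m" "m < q"
        using False by (auto simp: m_def Q'_def q'_def)
      define a' where "a' = real_of_int (a (Suc n))"
      define C where "C = \<alpha> (Suc (Suc n))"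
      have BC: "B * a' + B * C = 1"
        using step[of "Suc n"] B(3) by (simp add: a'_def B_def C_def field_simps)
      have "\<delta>\<^sup>2 \<le> real m * \<bar>real m * \<alpha> (Suc (Suc n)) - of_int (p - a (Suc n) * q')\<bar>"
        using m by (intro less.IH) auto
      also have "\<dots> = Q' * \<bar>Q' * C - (P - a' * Q')\<bar>"
        by (simp add: m C_def P_def Q'_def a'_def)
      also have "Q' * C - (P - a' * Q') = - ((P - Q * A) / (A * B))"
      proof -
        have "Q' * (B * a' + B * C) = Q'"
          by (simp add: BC)
        then have "Q' * C - (P - a' * Q') = - ((P * B - Q') / B)"
          using B by (simp add: field_simps)
        moreover have "(P - Q * A) / (A * B) = (P * B - Q') / B"
          using A by (simp add: err)
        ultimately show ?thesis
          by simp
      qed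
      also have "Q' * \<bar>- ((P - Q * A) / (A * B))\<bar> = Q' * ((P - Q * A) / (A * B))"
        using 3 A B by simp
      also have "\<dots> \<le> (Q * A * B) * ((P - Q * A) / (A * B))"
      proof (rule mult_right_mono)
        have "0 \<le> a n * (P - Q * A)"
          using 3 a_pos[of n] by simp
        moreover have "Q * (A * a n + A * B) = Q"
          by (simp add: AB)
        ultimately show "Q' \<le> Q * A * B"
          by (simp add: Q' algebra_simps)
        show "0 \<le> (P - Q * A) / (A * B)"
          using 3 A B by simp
      qed
      also have "\<dots> = Q * \<bar>Q * A - P\<bar>"
        using A B by (simp add: abs_err)
      finally show ?thesis .
    qed
  qed
  then show ?case
    by (simp add: Q_def A_def P_def)
qed

lemma complete_quotient_irrational:
  assumes "x \<notin> \<rat>"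
  shows "complete_quotient x n \<notin> \<rat>"
proof (induction n)
  case 0
  then show ?case using assms by simp
next
  case (Suc n)
  have "frac (complete_quotient x n) \<notin> \<rat>"
    using Suc Rats_add[OF Rats_of_int] by (metis frac_def add_diff_cancel_left' diff_add_cancel add.commute)
  then show ?case
    by (metis Rats_divide Rats_1 complete_quotient.simps(2) div_by_1 divide_divide_eq_right mult_1)
qed

lemma bounded_type_badly_approximable:
  assumes "bounded_type x"
  obtains c where "0 < c" "\<And>q p. 1 \<le> q \<Longrightarrow> c \<le> real q * \<bar>real q * x - of_int p\<bar>"
proof -
  define y where "y = complete_quotient x"
  obtain D where D: "\<And>n. \<lfloor>y n\<rfloor> \<le> D" and irr: "x \<notin> \<rat>"
    using assms by (auto simp: bounded_type_def cf_coeff_def y_def)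
  have y_Suc: "y (Suc n) = 1 / frac (y n)" for n
    by (simp add: y_def)
  have frac_pos: "0 < frac (y n)" for n
    using complete_quotient_irrational[OF irr, of n]
    by (metis Ints_subset_Rats frac_gt_0_iff subsetD y_def)
  have y_gt1: "1 < y (Suc n)" for n
    using frac_pos[of n] frac_lt_1[of "y n"] by (simp add: y_Suc)
  have D1: "1 \<le> D"
    using y_gt1[of 0] D[of "Suc 0"] by linarith
  define \<delta> where "\<delta> = 1 / (real_of_int D + 1)"
  have \<delta>: "0 < \<delta>"
    using D1 by (simp add: \<delta>_def)
  have frac_ge: "\<delta> \<le> frac (y n)" for n
  proof -
    have "1 / frac (y n) \<le> real_of_int D + 1"
      using D[of "Suc n"] unfolding y_Suc by linarith
    then show ?thesis
      using frac_pos[of n] D1 by (simp add: \<delta>_def field_simps)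
  qed
  have a_pos: "1 \<le> \<lfloor>y (Suc n)\<rfloor>" for n
    using y_gt1[of n] by linarith
  have step: "1 / frac (y n) = of_int \<lfloor>y (Suc n)\<rfloor> + frac (y (Suc n))" for n
    by (simp add: y_Suc frac_def)
  show thesis
  proof
    show "0 < \<delta>\<^sup>2" using \<delta> by simp
  next
    fix q :: nat and p :: int
    assume q: "1 \<le> q"
    have "\<delta>\<^sup>2 \<le> real q * \<bar>real q * frac (y 0) - of_int (p - int q * \<lfloor>x\<rfloor>)\<bar>"
      using gauss_orbit_badly_approximable
        [where \<alpha> = "\<lambda>n. frac (y n)" and a = "\<lambda>n. \<lfloor>y (Suc n)\<rfloor>",
          OF \<delta> frac_ge frac_lt_1 a_pos step q] .
    also have "real q * frac (y 0) - of_int (p - int q * \<lfloor>x\<rfloor>) = real q * x - of_int p"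
      by (simp add: y_def frac_def algebra_simps)
    finally show "\<delta>\<^sup>2 \<le> real q * \<bar>real q * x - of_int p\<bar>" .
  qed
qed

section \<open>The cosine and the distance to the nearest integer\<close>

lemma one_minus_cos_eq_sin_squared:
  "1 - cos (2 * pi * t) = 2 * (sin (pi * (t - of_int p)))\<^sup>2"
proof -
  have "cos (2 * pi * t) = cos (2 * pi * t - 2 * pi * of_int p)"
    by (simp add: cos_diff)
  also have "2 * pi * t - 2 * pi * of_int p = 2 * (pi * (t - of_int p))"
    by (simp add: algebra_simps)
  finally show ?thesis
    by (simp add: cos_double_sin)
qed

lemma one_minus_cos_le:
  "1 - cos (2 * pi * t) \<le> 2 * pi\<^sup>2 * (t - of_int p)\<^sup>2"
proof -
  have "(sin (pi * (t - of_int p)))\<^sup>2 \<le> (pi * (t - of_int p))\<^sup>2"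
    using abs_sin_x_le_abs_x by (simp add: abs_le_square_iff)
  then show ?thesis
    by (simp add: one_minus_cos_eq_sin_squared[of t p] power_mult_distrib)
qed

text \<open>Jordan's inequality: on \<open>[0, pi / 2]\<close> the concave function \<open>sin\<close> lies above its chord.\<close>

lemma jordan_sin_ge:
  fixes d :: real
  assumes "0 \<le> d" "d \<le> 1 / 2"
  shows "2 * d \<le> sin (pi * d)"
proof -
  have "concave_on {0..pi / 2} sin"
  proof (rule f''_le0_imp_concave)
    show "(sin has_real_derivative cos t) (at t)" for t :: real
      by (rule DERIV_sin)
    show "(cos has_real_derivative - sin t) (at t)" for t :: real
      by (rule DERIV_cos)
    show "- sin t \<le> 0" if "t \<in> {0..pi / 2}" for t :: real
      using that pi_gt_zero by (simp add: sin_ge_zero)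
  qed auto
  from concave_onD[OF this, of "2 * d" 0 "pi / 2"] show ?thesis
    using assms by (simp add: mult.commute)
qed

lemma one_minus_cos_ge:
  "8 * (t - of_int (round t))\<^sup>2 \<le> 1 - cos (2 * pi * t)"
proof -
  define d where "d = t - of_int (round t)"
  have "\<bar>d\<bar> \<le> 1 / 2"
    using of_int_round_abs_le[of t] by (simp add: d_def abs_minus_commute)
  then have "2 * \<bar>d\<bar> \<le> sin (pi * \<bar>d\<bar>)"
    by (intro jordan_sin_ge) auto
  then have "(2 * \<bar>d\<bar>)\<^sup>2 \<le> (sin (pi * \<bar>d\<bar>))\<^sup>2"
    by (intro power_mono) auto
  also have "(sin (pi * \<bar>d\<bar>))\<^sup>2 = (sin (pi * d))\<^sup>2"
    by (cases "0 \<le> d") auto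
  finally show ?thesis
    by (simp add: one_minus_cos_eq_sin_squared[of t "round t"] d_def power_mult_distrib)
qed

section \<open>The two bounds for the Margulis boundary\<close>

lemma margulis_boundary_ge:
  assumes "\<And>k. 1 \<le> k \<Longrightarrow> M \<le> (1 - cos (real k * \<theta>)) * r\<^sup>2 + (real k)\<^sup>2" and "0 < E"
  shows "1 / sqrt E * sqrt M \<le> margulis_boundary E \<theta> r"
  unfolding margulis_boundary_def
proof (rule cINF_greatest)
  show "{k::nat. 1 \<le> k} \<noteq> {}" by auto
qed (use assms in \<open>auto intro!: divide_right_mono real_sqrt_le_mono\<close>)

lemma margulis_boundary_le:
  assumes "1 \<le> k" "(1 - cos (real k * \<theta>)) * r\<^sup>2 + (real k)\<^sup>2 \<le> M" and "0 < E"
  shows "margulis_boundary E \<theta> r \<le> 1 / sqrt E * sqrt M"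
  unfolding margulis_boundary_def
proof (rule cINF_lower2)
  show "k \<in> {k. 1 \<le> k}" using assms by simp
  show "1 / sqrt E * sqrt ((1 - cos (real k * \<theta>)) * r\<^sup>2 + (real k)\<^sup>2) \<le> 1 / sqrt E * sqrt M"
    using assms by (intro mult_left_mono real_sqrt_le_mono) auto
  show "bdd_below ((\<lambda>k. 1 / sqrt E * sqrt ((1 - cos (real k * \<theta>)) * r\<^sup>2 + (real k)\<^sup>2)) ` {k. 1 \<le> k})"
    using assms by (intro bdd_belowI2[where m = 0]) auto
qed

lemma margulis_boundary_ge_sqrt:
  assumes c: "0 < c"
    and approx: "\<And>q p. 1 \<le> q \<Longrightarrow> c \<le> real q * \<bar>real q * x - of_int p\<bar>"
    and "0 < E" "0 < r"
  shows "1 / sqrt E * sqrt (4 * c * r) \<le> margulis_boundary E (2 * pi * x) r"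
proof (rule margulis_boundary_ge)
  fix k :: nat
  assume k: "1 \<le> k"
  define K where "K = real k"
  define d where "d = \<bar>K * x - of_int (round (K * x))\<bar>"
  have K: "0 < K" using k by (simp add: K_def)
  have "c \<le> K * d"
    using approx[OF k, of "round (K * x)"] by (simp add: K_def d_def)
  then have "4 * c * r \<le> 4 * (K * d) * r"
    using assms by simp
  \<comment> \<open>The inequality of arithmetic and geometric means for \<open>(2 * d * r)\<^sup>2\<close> and \<open>K\<^sup>2\<close>.\<close>
  also have "\<dots> \<le> 4 * d\<^sup>2 * r\<^sup>2 + K\<^sup>2"
    using zero_le_power2[of "2 * d * r - K"] by (simp add: power2_eq_square algebra_simps)
  also have "\<dots> \<le> (8 * d\<^sup>2) * r\<^sup>2 + K\<^sup>2"
    by simp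
  also have "8 * d\<^sup>2 \<le> 1 - cos (K * (2 * pi * x))"
    using one_minus_cos_ge[of "K * x"] by (simp add: d_def algebra_simps)
  finally show "4 * c * r \<le> (1 - cos (real k * (2 * pi * x))) * r\<^sup>2 + (real k)\<^sup>2"
    by (simp add: K_def mult_right_mono)
qed fact

lemma margulis_boundary_le_sqrt:
  assumes "1 \<le> r" "0 < E"
  shows "margulis_boundary E (2 * pi * x) r \<le> 1 / sqrt E * sqrt ((2 * pi\<^sup>2 + 4) * r)"
proof -
  define s where "s = sqrt r"
  have s: "1 \<le> s" and r: "r = s\<^sup>2"
    using assms by (auto simp: s_def)
  define N where "N = nat \<lceil>s\<rceil>"
  have N: "s \<le> real N" "real N \<le> 2 * s" "0 < N"
    using s unfolding N_def by linarith+
  obtain p k where k: "0 < k" "k \<le> int N" and kp: "\<bar>of_int k * x - of_int p\<bar> < 1 / real N"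
    using Dirichlet_approx[OF \<open>0 < N\<close>] .
  define K where "K = real_of_int k"
  have K: "0 < K" "K \<le> 2 * s"
    using k N by (auto simp: K_def)
  have "\<bar>K * x - of_int p\<bar> \<le> 1 / s"
    using kp N s frac_le[of 1 1 s "real N"] by (auto simp: K_def)
  then have "(K * x - of_int p)\<^sup>2 \<le> (1 / s)\<^sup>2"
    by (metis abs_ge_zero power2_abs power_mono)
  then have d: "(K * x - of_int p)\<^sup>2 * r \<le> 1"
    using s by (simp add: r field_simps)
  have "(1 - cos (K * (2 * pi * x))) * r\<^sup>2 \<le> 2 * pi\<^sup>2 * (K * x - of_int p)\<^sup>2 * r\<^sup>2"
    using one_minus_cos_le[of "K * x" p] by (intro mult_right_mono) (auto simp: algebra_simps)
  also have "\<dots> = 2 * pi\<^sup>2 * r * ((K * x - of_int p)\<^sup>2 * r)"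
    by (simp add: power2_eq_square)
  also have "\<dots> \<le> 2 * pi\<^sup>2 * r * 1"
    using d assms by (intro mult_left_mono) auto
  finally have "(1 - cos (K * (2 * pi * x))) * r\<^sup>2 \<le> 2 * pi\<^sup>2 * r"
    by simp
  moreover have "K\<^sup>2 \<le> 4 * r"
    using power_mono[of K "2 * s" 2] K by (simp add: r power_mult_distrib)
  ultimately have *: "(1 - cos (K * (2 * pi * x))) * r\<^sup>2 + K\<^sup>2 \<le> (2 * pi\<^sup>2 + 4) * r"
    by (simp add: algebra_simps)
  have "real (nat k) = K"
    using k by (simp add: K_def)
  then show ?thesis
    using * k assms by (intro margulis_boundary_le[where k = "nat k"]) auto
qed

theorem theorem3p9:
  fixes \<theta> E :: real
  assumes "\<theta> \<in> {0<..<2 * pi}"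
    and "\<theta> / (2 * pi) \<notin> \<rat>"
    and "bounded_type (\<theta> / (2 * pi))"
    and "E > 0"
  shows "comparable (margulis_boundary E \<theta>) sqrt"
proof -
  define x where "x = \<theta> / (2 * pi)"
  have \<theta>: "\<theta> = 2 * pi * x"
    by (simp add: x_def)
  obtain c where c: "0 < c" "\<And>q p. 1 \<le> q \<Longrightarrow> c \<le> real q * \<bar>real q * x - of_int p\<bar>"
    using bounded_type_badly_approximable assms(3) unfolding x_def by blast
  define l where "l = 1 / sqrt E * sqrt (4 * c)"
  define u where "u = 1 / sqrt E * sqrt (2 * pi\<^sup>2 + 4)"
  have pos: "0 < l" "0 < u"
    using c assms by (auto simp: l_def u_def add_nonneg_pos)
  have bounds: "l * sqrt r \<le> margulis_boundary E \<theta> r" "margulis_boundary E \<theta> r \<le> u * sqrt r"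
    if "1 < r" for r
    using margulis_boundary_ge_sqrt[OF c \<open>E > 0\<close>, of r] margulis_boundary_le_sqrt[of r E x] that assms
    by (auto simp: l_def u_def \<theta> real_sqrt_mult)
  \<comment> \<open>Halving and doubling the constants makes the inequalities strict.\<close>
  have "l / 2 * sqrt r < margulis_boundary E \<theta> r \<and> margulis_boundary E \<theta> r < 2 * u * sqrt r"
    if "1 < r" for r
  proof -
    have "0 < l * sqrt r" "0 < u * sqrt r"
      using pos that by auto
    then show ?thesis
      using bounds[OF that] by simp
  qed
  with pos show ?thesis
    unfolding comparable_def
    by (intro exI[of _ "l / 2"] exI[of _ "2 * u"] exI[of _ 1]) auto
qed

end
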